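(* For any integer $n\geq 2$, the map $d_r\colon(\mathbb{R}^2)^n\to[0,+\infty[$ that associates with any $(x_1,\ldots,x_n)\in(\mathbb{R}^2)^n$ the radius of $S(x_1,\ldots,x_n)$ is an $n$-distance on $\mathbb{R}^2$ whose best constant is $K_n^*=\frac{1}{n-1}$.
   Context: $S(x_1,\ldots,x_n)$ denotes the smallest circle (for the Euclidean distance, possibly of radius $0$) enclosing the points $x_1,\ldots,x_n\in\mathbb{R}^2$, i.e. the boundary of the unique closed disk of minimal radius containing $\{x_1,\ldots,x_n\}$; it exists and is unique. For a function $f\colon X^n\to[0,+\infty[$, $f(x_1,\ldots,x_n)_i^z$ denotes the value of $f$ at $(x_1,\ldots,x_{i-1},z,x_{i+1},\ldots,x_n)$. An $n$-distance on a nonempty set $X$ is a function $f\colon X^n\to[0,+\infty[$ such that: (i) $f(x_1,\ldots,x_n)\leq\sum_{i=1}^n f(x_1,\ldots,x_n)_i^z$ for all $x_1,\ldots,x_n,z\in X$; (ii) $f$ is invariant under all permutations of its arguments; (iii) $f(x_1,\ldots,x_n)=0$ if and only if $x_1=\cdots=x_n$. The best constant $K_n^*$ associated with an $n$-distance $f$ is the infimum of the set of real numbers $K\in\,]0,1]$ such that $f(x_1,\ldots,x_n)\leq K\sum_{i=1}^n f(x_1,\ldots,x_n)_i^z$ for all $x_1,\ldots,x_n,z\in X$. *)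

theory Defs
  imports "HOL-Analysis.Analysis" "HOL-Combinatorics.Permutations"
begin

text \<open>
  An element of \<open>X\<^sup>n\<close> is a list of length \<open>n\<close> with entries in \<open>X\<close>, indexed from \<open>0\<close>; a function on
  \<open>X\<^sup>n\<close> is a function on lists, of which only the values on \<open>tuples n X\<close> matter.
\<close>
definition tuples :: "nat \<Rightarrow> 'a set \<Rightarrow> 'a list set" where
  "tuples n X = {xs. length xs = n \<and> set xs \<subseteq> X}"

text \<open>The value of \<open>f\<close> at \<open>xs\<close> with the entry at position \<open>i\<close> replaced by \<open>z\<close> is \<open>f (xs[i := z])\<close>.\<close>
definition n_distance :: "nat \<Rightarrow> 'a set \<Rightarrow> ('a list \<Rightarrow> real) \<Rightarrow> bool" where
  "n_distance n X f \<longleftrightarrow>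
     X \<noteq> {} \<and>
     (\<forall>xs\<in>tuples n X. 0 \<le> f xs) \<and>
     (\<forall>xs\<in>tuples n X. \<forall>z\<in>X. f xs \<le> (\<Sum>i<n. f (xs[i := z]))) \<and>
     (\<forall>xs\<in>tuples n X. \<forall>\<sigma>. \<sigma> permutes {..<n} \<longrightarrow> f (permute_list \<sigma> xs) = f xs) \<and>
     (\<forall>xs\<in>tuples n X. f xs = 0 \<longleftrightarrow> (\<forall>i<n. \<forall>j<n. xs ! i = xs ! j))"

definition best_constant :: "nat \<Rightarrow> 'a set \<Rightarrow> ('a list \<Rightarrow> real) \<Rightarrow> real" where
  "best_constant n X f =
     Inf {K. 0 < K \<and> K \<le> 1 \<and>
             (\<forall>xs\<in>tuples n X. \<forall>z\<in>X. f xs \<le> K * (\<Sum>i<n. f (xs[i := z])))}"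

definition is_minimal_enclosing_disk :: "(real^2) set \<Rightarrow> (real^2) set \<Rightarrow> bool" where
  "is_minimal_enclosing_disk A D \<longleftrightarrow>
     (\<exists>c r. 0 \<le> r \<and> D = cball c r \<and> A \<subseteq> D \<and>
            (\<forall>c' r'. 0 \<le> r' \<and> A \<subseteq> cball c' r' \<longrightarrow> r \<le> r'))"

text \<open>The circle is a set of points; it degenerates to a single point when the radius is \<open>0\<close>.\<close>
definition smallest_circle :: "(real^2) list \<Rightarrow> (real^2) set" where
  "smallest_circle xs = frontier (THE D. is_minimal_enclosing_disk (set xs) D)"

definition circle_radius :: "(real^2) set \<Rightarrow> real" where
  "circle_radius C = (THE r. 0 \<le> r \<and> (\<exists>c. C = sphere c r))"

definition d_r :: "(real^2) list \<Rightarrow> real" where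
  "d_r xs = circle_radius (smallest_circle xs)"

end

theory Submission
  imports Defs
begin

text \<open>
  Let \<open>r\<close> be the radius and \<open>c\<close> the centre of the smallest disk around \<open>x\<^sub>1, \<dots>, x\<^sub>n\<close>. Minimality
  forces \<open>c\<close> into the convex hull of the points on the boundary circle, for otherwise \<open>c\<close> could be
  shifted towards all of them at once (\<open>centre_in_convex_hull_contact\<close>); by Caratheodory, \<open>c\<close> is
  already in the convex hull of a set \<open>S\<close> of at most three of them. Conversely, such an \<open>S\<close>
  fits into no disk of radius less than \<open>r\<close> (\<open>radius_le_if_centre_in_convex_hull\<close>). This gives
  uniqueness of the disk, and it shows that replacing an entry whose position is not needed to
  cover \<open>S\<close> does not decrease the radius.

  For the bound with constant \<open>1 / (n - 1)\<close> the at most three entries that cover \<open>S\<close> remain. They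
  must contribute \<open>card S - 1\<close> times \<open>r\<close>. If \<open>S = {a, b}\<close>, then \<open>dist a b = 2 * r\<close>, and the triangle
  inequality \<open>dist a z + dist z b \<ge> dist a b\<close> suffices, as half a distance is a lower bound for the
  radius. If \<open>S\<close> has three elements, then each of the three new tuples still contains two of them,
  so it is enough that the perimeter of \<open>S\<close> is at least \<open>4 * r\<close> (\<open>perimeter_ge\<close>). That is a
  property of non-obtuse triangles: with the circumcentre as origin, \<open>a + b + c\<close> is the
  orthocentre, which lies in the circumscribed disk (\<open>norm_orthocentre_le\<close>).

  The constant is optimal because of the tuple \<open>(a, b, \<dots>, b)\<close> with \<open>a \<noteq> b\<close> and \<open>z = b\<close>: one of the
  new tuples is constant, and the other \<open>n - 1\<close> have the same radius as the original one.
\<close>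

section \<open>Smallest enclosing balls\<close>

text \<open>
  As \<open>c\<close> is in their convex hull, the points of \<open>S\<close> cannot all lie strictly on the side of \<open>c'\<close> as
  seen from \<open>c\<close>. For a point \<open>s\<close> that does not, the triangle \<open>s c c'\<close> has no acute angle at \<open>c\<close>, and
  the law of cosines bounds \<open>dist c' s\<close> from below. The term \<open>(dist c c')\<^sup>2\<close> is what makes the
  smallest enclosing ball unique.
\<close>
lemma centre_dist_le_if_centre_in_convex_hull:
  fixes c c' :: "'a::real_inner"
  assumes "S \<subseteq> sphere c r" "c \<in> convex hull S" "S \<subseteq> cball c' r'"
  shows "r\<^sup>2 + (dist c c')\<^sup>2 \<le> r'\<^sup>2"
proof -
  have "\<exists>s\<in>S. (s - c) \<bullet> (c' - c) \<le> 0"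
  proof (rule ccontr)
    assume "\<not> ?thesis"
    then have "S \<subseteq> {x. (c' - c) \<bullet> x > (c' - c) \<bullet> c}"
      by (force simp: inner_diff_left inner_diff_right inner_commute)
    then have "convex hull S \<subseteq> {x. (c' - c) \<bullet> x > (c' - c) \<bullet> c}"
      by (rule hull_minimal) (rule convex_halfspace_gt)
    with assms(2) show False by auto
  qed
  then obtain s where s: "s \<in> S" "(s - c) \<bullet> (c' - c) \<le> 0" by blast
  have "(dist c' s)\<^sup>2 = (dist c s)\<^sup>2 - 2 * ((s - c) \<bullet> (c' - c)) + (dist c c')\<^sup>2"
    by (simp add: dist_norm power2_norm_eq_inner inner_diff_left inner_diff_right inner_commute)
  moreover have "dist c s = r" and "dist c' s \<le> r'"
    using s(1) assms(1,3) by auto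
  moreover have "(dist c' s)\<^sup>2 \<le> r'\<^sup>2"
    using \<open>dist c' s \<le> r'\<close> by (intro power_mono) auto
  ultimately show ?thesis using s(2) by simp
qed

lemma radius_le_if_centre_in_convex_hull:
  fixes c c' :: "'a::real_inner"
  assumes "S \<subseteq> sphere c r" "c \<in> convex hull S" "S \<subseteq> cball c' r'"
  shows "r \<le> r'"
proof -
  obtain s where "s \<in> S" using assms(2) by fastforce
  then have "0 \<le> r'" using assms(3) by (force intro: order_trans[OF zero_le_dist])
  moreover have "r\<^sup>2 \<le> r'\<^sup>2"
    using centre_dist_le_if_centre_in_convex_hull[OF assms] zero_le_power2[of "dist c c'"]
    by linarith
  ultimately show ?thesis by (rule power2_le_imp_le[rotated])
qed

lemma exists_minimal_enclosing_ball:
  fixes A :: "'a::euclidean_space set"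
  assumes "bounded A" "A \<noteq> {}"
  obtains c r where "0 \<le> r" "A \<subseteq> cball c r" "\<And>c' r'. A \<subseteq> cball c' r' \<Longrightarrow> r \<le> r'"
proof -
  obtain a where a: "a \<in> A" using assms(2) by blast
  obtain R where R: "A \<subseteq> cball a R"
    using assms(1) unfolding bounded_any_center[of A a] by (meson mem_cball subsetI)
  have "0 \<le> R" using a R by auto
  define K where "K = {p :: 'a \<times> real. snd p \<in> {0..R} \<and> A \<subseteq> cball (fst p) (snd p)}"
  have "K = {p. 0 \<le> snd p} \<inter> {p. snd p \<le> R} \<inter> (\<Inter>x\<in>A. {p. dist (fst p) x \<le> snd p})"
    unfolding K_def by auto
  moreover have "closed \<dots>"
    by (intro closed_Int closed_INT ballI closed_Collect_le continuous_intros)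
  ultimately have "closed K" by simp
  moreover have "K \<subseteq> cball a R \<times> {0..R}"
    using a unfolding K_def by (force simp: dist_commute)
  then have "bounded K"
    by (rule bounded_subset[rotated]) (intro bounded_Times bounded_cball bounded_closed_interval)
  ultimately have "compact K" by (simp add: compact_eq_bounded_closed)
  have aR: "(a, R) \<in> K" using R \<open>0 \<le> R\<close> by (simp add: K_def)
  then obtain p where p: "p \<in> K" "\<And>q. q \<in> K \<Longrightarrow> snd p \<le> snd q"
    using continuous_attains_inf[OF \<open>compact K\<close> _ continuous_on_snd[OF continuous_on_id]] by blast
  show thesis
  proof
    show "0 \<le> snd p" "A \<subseteq> cball (fst p) (snd p)" using p(1) by (auto simp: K_def)
    fix c' r' assume *: "A \<subseteq> cball c' r'"
    show "snd p \<le> r'"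
    proof (cases "r' \<le> R")
      case True
      have "0 \<le> r'" using a * by (force intro: order_trans[OF zero_le_dist])
      with True * have "(c', r') \<in> K" by (simp add: K_def)
      then show ?thesis using p(2) by fastforce
    next
      case False
      then show ?thesis using p(2)[OF aR] by simp
    qed
  qed
qed

text \<open>
  Otherwise a hyperplane separates \<open>c\<close> from the contact points. A small step from \<open>c\<close> in its
  normal direction brings the contact points closer than \<open>r\<close>, and leaves the other points, of
  which there are finitely many, at a distance less than \<open>r\<close>.
\<close>
lemma centre_in_convex_hull_contact:
  fixes A :: "'a::euclidean_space set"
  assumes "finite A" "A \<subseteq> cball c r" and min: "\<And>c' r'. A \<subseteq> cball c' r' \<Longrightarrow> r \<le> r'"
  shows "c \<in> convex hull (A \<inter> sphere c r)"
proof (rule ccontr)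
  assume c: "c \<notin> convex hull (A \<inter> sphere c r)"
  have "closed (convex hull (A \<inter> sphere c r))"
    using assms(1) by (intro compact_imp_closed compact_convex_hull finite_imp_compact) auto
  with c obtain u b where u: "u \<bullet> c < b" "\<forall>x\<in>convex hull (A \<inter> sphere c r). b < u \<bullet> x"
    using separating_hyperplane_closed_point[of "convex hull (A \<inter> sphere c r)" c] by auto
  have "\<forall>\<^sub>F t in at_right 0. dist (c + t *\<^sub>R u) x < r" if x: "x \<in> A" for x
  proof (cases "dist c x = r")
    case True
    with x have "x \<in> convex hull (A \<inter> sphere c r)" by (intro hull_inc) simp
    with u(2) have "u \<bullet> x > b" by blast
    then have pos: "0 < 2 * (u \<bullet> (x - c))" using u(1) by (simp add: inner_diff_right)
    have "((\<lambda>t. t * (norm u)\<^sup>2) \<longlongrightarrow> 0 * (norm u)\<^sup>2) (at_right (0::real))"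
      by (intro tendsto_intros)
    then have "\<forall>\<^sub>F t in at_right 0. t * (norm u)\<^sup>2 < 2 * (u \<bullet> (x - c))"
      using pos by (intro order_tendstoD) auto
    moreover have "\<forall>\<^sub>F t::real in at_right 0. 0 < t" by (rule eventually_at_right_less)
    ultimately show ?thesis
    proof eventually_elim
      case (elim t)
      have "(dist (c + t *\<^sub>R u) x)\<^sup>2 = r\<^sup>2 + t * (t * (norm u)\<^sup>2 - 2 * (u \<bullet> (x - c)))"
        unfolding True[symmetric]
        by (simp add: dist_norm power2_norm_eq_inner inner_diff_left inner_diff_right
            inner_add_left inner_add_right inner_commute algebra_simps)
      also have "\<dots> < r\<^sup>2" using elim by (simp add: mult_pos_neg)
      finally show ?case
        using True by (metis power2_less_imp_less zero_le_dist)
    qed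
  next
    case False
    then have "dist c x < r" using assms(2) x by force
    moreover have "((\<lambda>t. dist (c + t *\<^sub>R u) x) \<longlongrightarrow> dist (c + 0 *\<^sub>R u) x) (at_right 0)"
      by (intro tendsto_intros)
    ultimately show ?thesis by (intro order_tendstoD) auto
  qed
  then have "\<forall>\<^sub>F t in at_right 0. \<forall>x\<in>A. dist (c + t *\<^sub>R u) x < r"
    using assms(1) by (simp add: eventually_ball_finite)
  then obtain t where t: "\<forall>x\<in>A. dist (c + t *\<^sub>R u) x < r"
    using eventually_happens[of _ "at_right (0::real)"] by (auto simp: trivial_limit_at_right_real)
  have "\<exists>r'<r. A \<subseteq> cball (c + t *\<^sub>R u) r'"
  proof (cases "A = {}")
    case True
    then show ?thesis by (intro exI[of _ "r - 1"]) simp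
  next
    case False
    with t assms(1) show ?thesis
      by (intro exI[of _ "Max (dist (c + t *\<^sub>R u) ` A)"]) auto
  qed
  with min show False by fastforce
qed

section \<open>The radius of the smallest enclosing circle\<close>

text \<open>Each of the two spheres has its centre in its convex hull, hence fits into no smaller ball.\<close>
lemma sphere_radius_unique:
  fixes c c' :: "'a::euclidean_space"
  assumes "0 \<le> r" "0 \<le> r'" "sphere c r = sphere c' r'"
  shows "r = r'"
proof -
  have centre: "x \<in> convex hull (sphere x \<rho>)" if nonneg: "0 \<le> \<rho>" for x :: 'a and \<rho>
  proof -
    obtain v :: 'a where v: "norm v = \<rho>" by (rule vector_choose_size[OF nonneg])
    have "convex hull {x + v, x - v} \<subseteq> convex hull (sphere x \<rho>)"
      using v by (intro hull_mono) (auto simp: dist_norm)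
    moreover have "x = (1/2) *\<^sub>R (x + v) + (1/2) *\<^sub>R (x - v)"
      by (simp add: algebra_simps flip: scaleR_add_left)
    then have "x \<in> convex hull {x + v, x - v}"
      unfolding convex_hull_2 by (intro CollectI exI[of _ "1/2"] conjI) auto
    ultimately show ?thesis by blast
  qed
  show ?thesis
  proof (rule antisym)
    show "r \<le> r'"
      using radius_le_if_centre_in_convex_hull[OF order_refl centre[OF assms(1), of c], of c' r']
      by (simp add: assms(3))
    show "r' \<le> r"
      using radius_le_if_centre_in_convex_hull[OF order_refl centre[OF assms(2), of c'], of c r]
      by (simp flip: assms(3))
  qed
qed

lemma d_r_eqI:
  assumes "0 \<le> r" "set xs \<subseteq> cball c r" "c \<in> convex hull (set xs \<inter> sphere c r)"
  shows "d_r xs = r"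
proof -
  note support = centre_dist_le_if_centre_in_convex_hull[OF Int_lower2 assms(3)]
  note le = radius_le_if_centre_in_convex_hull[OF Int_lower2 assms(3)]
  have "is_minimal_enclosing_disk (set xs) D \<longleftrightarrow> D = cball c r" for D
  proof
    assume "D = cball c r"
    then show "is_minimal_enclosing_disk (set xs) D"
      unfolding is_minimal_enclosing_disk_def using assms(1,2) le by blast
  next
    assume "is_minimal_enclosing_disk (set xs) D"
    then obtain c' r' where D: "D = cball c' r'" "0 \<le> r'" "set xs \<subseteq> cball c' r'" "r' \<le> r"
      unfolding is_minimal_enclosing_disk_def using assms(1,2) by blast
    have "r \<le> r'" using le D(3) by blast
    with D(4) have "r' = r" by simp
    moreover have "(dist c c')\<^sup>2 \<le> 0"
      using support[of c' r'] D(3) \<open>r' = r\<close> by auto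
    then have "c' = c" by simp
    ultimately show "D = cball c r" using D(1) by simp
  qed
  then have "smallest_circle xs = sphere c r"
    by (simp add: smallest_circle_def)
  moreover have "(THE \<rho>. 0 \<le> \<rho> \<and> (\<exists>c'. sphere c r = sphere c' \<rho>)) = r"
    using assms(1) sphere_radius_unique by (intro the_equality) blast+
  ultimately show ?thesis by (simp add: d_r_def circle_radius_def)
qed

text \<open>
  A disk of the given radius around all points, together with a small certificate that no smaller
  disk exists: \<open>S\<close> is the \<open>S\<close> of \<open>radius_le_if_centre_in_convex_hull\<close>.
\<close>
lemma d_r_support:
  assumes "xs \<noteq> []"
  obtains c S where "set xs \<subseteq> cball c (d_r xs)" "S \<subseteq> set xs" "S \<subseteq> sphere c (d_r xs)"
    "c \<in> convex hull S" "card S \<le> 3"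
proof -
  obtain c r where cr: "0 \<le> r" "set xs \<subseteq> cball c r"
    "\<And>c' r'. set xs \<subseteq> cball c' r' \<Longrightarrow> r \<le> r'"
    by (rule exists_minimal_enclosing_ball[of "set xs"]) (simp_all add: assms finite_imp_bounded)
  have hull: "c \<in> convex hull (set xs \<inter> sphere c r)"
    using cr(2,3) by (intro centre_in_convex_hull_contact) auto
  have d: "d_r xs = r" using d_r_eqI[OF cr(1,2) hull] .
  obtain S where "S \<subseteq> set xs \<inter> sphere c r" "card S \<le> 3" "c \<in> convex hull S"
    using hull unfolding caratheodory[of "set xs \<inter> sphere c r"] by auto
  with that[of c S] cr(2) show thesis by (simp add: d)
qed

lemma ex_cball_d_r:
  assumes "xs \<noteq> []"
  shows "\<exists>c. set xs \<subseteq> cball c (d_r xs)"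
  using d_r_support[OF assms] by metis

lemma d_r_le:
  assumes "xs \<noteq> []" "set xs \<subseteq> cball c r"
  shows "d_r xs \<le> r"
proof -
  obtain p S where "set xs \<subseteq> cball p (d_r xs)" "S \<subseteq> set xs" "S \<subseteq> sphere p (d_r xs)"
    "p \<in> convex hull S" "card S \<le> 3"
    by (rule d_r_support[OF assms(1)])
  with assms(2) show ?thesis
    by (intro radius_le_if_centre_in_convex_hull[of S p "d_r xs" c r]) auto
qed

lemma d_r_nonneg:
  assumes "xs \<noteq> []"
  shows "0 \<le> d_r xs"
proof -
  obtain c where "set xs \<subseteq> cball c (d_r xs)" using ex_cball_d_r[OF assms] by blast
  moreover have "hd xs \<in> set xs" using assms by simp
  ultimately have "dist c (hd xs) \<le> d_r xs" by (auto simp del: hd_in_set)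
  then show ?thesis using zero_le_dist[of c "hd xs"] by linarith
qed

lemma d_r_mono:
  assumes "xs \<noteq> []" "set xs \<subseteq> set ys"
  shows "d_r xs \<le> d_r ys"
proof -
  have "ys \<noteq> []" using assms by auto
  then obtain c where "set ys \<subseteq> cball c (d_r ys)" using ex_cball_d_r by blast
  with assms show ?thesis by (intro d_r_le[of xs c]) auto
qed

lemma half_dist_le_d_r:
  assumes "a \<in> set xs" "b \<in> set xs"
  shows "dist a b / 2 \<le> d_r xs"
proof -
  obtain c where "set xs \<subseteq> cball c (d_r xs)" using ex_cball_d_r[of xs] assms by fastforce
  then have "dist c a \<le> d_r xs" "dist c b \<le> d_r xs" using assms by auto
  then show ?thesis using dist_triangle3[of a b c] by linarith
qed

lemma d_r_eq_0_iff:
  assumes "xs \<noteq> []"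
  shows "d_r xs = 0 \<longleftrightarrow> (\<forall>x\<in>set xs. \<forall>y\<in>set xs. x = y)"
proof
  assume "d_r xs = 0"
  then show "\<forall>x\<in>set xs. \<forall>y\<in>set xs. x = y"
    using half_dist_le_d_r[of _ xs] by fastforce
next
  assume *: "\<forall>x\<in>set xs. \<forall>y\<in>set xs. x = y"
  have "set xs \<subseteq> cball (hd xs) 0"
  proof
    fix x assume "x \<in> set xs"
    then have "hd xs = x" using * hd_in_set[OF assms] by blast
    then show "x \<in> cball (hd xs) 0" by simp
  qed
  then have "d_r xs \<le> 0" using assms by (rule d_r_le[rotated])
  then show "d_r xs = 0" using d_r_nonneg[OF assms] by simp
qed

section \<open>The perimeter of a triangle that contains its circumcentre\<close>

text \<open>
  Subtracting the vanishing combination from \<open>\<beta> (a + b + c)\<close>, where \<open>\<beta>\<close> is the middle weight,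
  eliminates \<open>b\<close> and leaves coefficients of total size \<open>\<alpha> - \<gamma>\<close>. This is at most \<open>\<beta>\<close>, because
  \<open>\<alpha> a = - (\<beta> b + \<gamma> c)\<close> and all three vectors have the same length.
\<close>
lemma norm_orthocentre_le_sorted:
  fixes a b c :: "'a::real_normed_vector"
  assumes norms: "norm a = r" "norm b = r" "norm c = r" and "0 < r"
    and "\<alpha> *\<^sub>R a + \<beta> *\<^sub>R b + \<gamma> *\<^sub>R c = 0"
    and "0 \<le> \<gamma>" "\<gamma> \<le> \<beta>" "\<beta> \<le> \<alpha>" "0 < \<alpha>"
  shows "norm (a + b + c) \<le> r"
proof -
  have "\<alpha> *\<^sub>R a = - (\<beta> *\<^sub>R b + \<gamma> *\<^sub>R c)"
    using assms(5) unfolding eq_neg_iff_add_eq_0 by (simp add: add.assoc)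
  then have "norm (\<alpha> *\<^sub>R a) \<le> norm (\<beta> *\<^sub>R b) + norm (\<gamma> *\<^sub>R c)"
    by (metis norm_minus_cancel norm_triangle_ineq)
  then have "\<alpha> * r \<le> (\<beta> + \<gamma>) * r"
    using assms by (simp add: distrib_right)
  with \<open>0 < r\<close> have le: "\<alpha> \<le> \<beta> + \<gamma>" by simp
  with assms have "0 < \<beta>" by linarith
  have "\<beta> *\<^sub>R (a + b + c) = (\<beta> - \<alpha>) *\<^sub>R a + (\<beta> - \<gamma>) *\<^sub>R c + (\<alpha> *\<^sub>R a + \<beta> *\<^sub>R b + \<gamma> *\<^sub>R c)"
    by (simp add: algebra_simps)
  also have "\<dots> = (\<beta> - \<alpha>) *\<^sub>R a + (\<beta> - \<gamma>) *\<^sub>R c"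
    using assms(5) by simp
  finally have "\<beta> * norm (a + b + c) = norm ((\<beta> - \<alpha>) *\<^sub>R a + (\<beta> - \<gamma>) *\<^sub>R c)"
    using \<open>0 < \<beta>\<close> by (metis abs_of_pos norm_scaleR)
  also have "\<dots> \<le> (\<alpha> - \<beta>) * r + (\<beta> - \<gamma>) * r"
    using norm_triangle_ineq[of "(\<beta> - \<alpha>) *\<^sub>R a" "(\<beta> - \<gamma>) *\<^sub>R c"] assms by simp
  also have "\<dots> = (\<alpha> - \<gamma>) * r" by (simp add: algebra_simps)
  also have "\<dots> \<le> \<beta> * r" using le \<open>0 < r\<close> by (intro mult_right_mono) auto
  finally show ?thesis using \<open>0 < \<beta>\<close> by simp
qed

lemma norm_orthocentre_le:
  fixes a b c :: "'a::real_normed_vector"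
  assumes norms: "norm a = r" "norm b = r" "norm c = r" and "0 < r"
    and "0 \<in> convex hull {a, b, c}"
  shows "norm (a + b + c) \<le> r"
proof -
  obtain \<alpha> \<beta> \<gamma> where w: "0 \<le> \<alpha>" "0 \<le> \<beta>" "0 \<le> \<gamma>" "\<alpha> + \<beta> + \<gamma> = 1"
    "\<alpha> *\<^sub>R a + \<beta> *\<^sub>R b + \<gamma> *\<^sub>R c = 0"
    using assms(5) unfolding convex_hull_3 by auto
  consider "\<gamma> \<le> \<beta>" "\<beta> \<le> \<alpha>" | "\<beta> \<le> \<gamma>" "\<gamma> \<le> \<alpha>" | "\<gamma> \<le> \<alpha>" "\<alpha> \<le> \<beta>"
    | "\<alpha> \<le> \<gamma>" "\<gamma> \<le> \<beta>" | "\<beta> \<le> \<alpha>" "\<alpha> \<le> \<gamma>" | "\<alpha> \<le> \<beta>" "\<beta> \<le> \<gamma>"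
    by linarith
  then show ?thesis
  proof cases
    case 1
    then show ?thesis
      using norm_orthocentre_le_sorted[of a r b c \<alpha> \<beta> \<gamma>] assms w by (simp add: ac_simps)
  next
    case 2
    then show ?thesis
      using norm_orthocentre_le_sorted[of a r c b \<alpha> \<gamma> \<beta>] assms w by (simp add: ac_simps)
  next
    case 3
    then show ?thesis
      using norm_orthocentre_le_sorted[of b r a c \<beta> \<alpha> \<gamma>] assms w by (simp add: ac_simps)
  next
    case 4
    then show ?thesis
      using norm_orthocentre_le_sorted[of b r c a \<beta> \<gamma> \<alpha>] assms w by (simp add: ac_simps)
  next
    case 5
    then show ?thesis
      using norm_orthocentre_le_sorted[of c r a b \<gamma> \<alpha> \<beta>] assms w by (simp add: ac_simps)
  next
    case 6
    then show ?thesis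
      using norm_orthocentre_le_sorted[of c r b a \<gamma> \<beta> \<alpha>] assms w by (simp add: ac_simps)
  qed
qed

text \<open>
  A chord has length at most \<open>2 * r\<close>, hence at least its square divided by \<open>2 * r\<close>; and the sum of
  the squared side lengths is \<open>9 * r\<^sup>2\<close> minus the squared norm of the orthocentre.
\<close>
lemma perimeter_ge:
  fixes a b c :: "'a::real_inner"
  assumes sph: "{a, b, c} \<subseteq> sphere p r" and hull: "p \<in> convex hull {a, b, c}"
  shows "4 * r \<le> dist a b + dist b c + dist c a"
proof (cases "0 < r")
  case True
  define a' b' c' where defs: "a' = a - p" "b' = b - p" "c' = c - p"
  have norms: "norm a' = r" "norm b' = r" "norm c' = r"
    using sph by (auto simp: defs dist_norm norm_minus_commute)
  have "convex hull {a', b', c'} = (\<lambda>x. -p + x) ` (convex hull {a, b, c})"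
    using convex_hull_translation[of "-p" "{a, b, c}"] by (simp add: defs)
  with hull have "0 \<in> convex hull {a', b', c'}" by (metis add.left_inverse image_eqI)
  with norms True have "norm (a' + b' + c') \<le> r" by (intro norm_orthocentre_le)
  then have H: "(norm (a' + b' + c'))\<^sup>2 \<le> r\<^sup>2" by (intro power_mono) auto
  have chord: "(norm (x - y))\<^sup>2 \<le> 2 * r * norm (x - y)"
    if "norm x = r" "norm y = r" for x y :: 'a
    using norm_triangle_ineq4[of x y] that by (simp add: power2_eq_square mult_right_mono)
  have "(norm (a' - b'))\<^sup>2 + (norm (b' - c'))\<^sup>2 + (norm (c' - a'))\<^sup>2 + (norm (a' + b' + c'))\<^sup>2
      = 3 * ((norm a')\<^sup>2 + (norm b')\<^sup>2 + (norm c')\<^sup>2)"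
    by (simp add: power2_norm_eq_inner inner_diff_left inner_diff_right
        inner_add_left inner_add_right inner_commute)
  then have "2 * r * (4 * r)
      \<le> (norm (a' - b'))\<^sup>2 + (norm (b' - c'))\<^sup>2 + (norm (c' - a'))\<^sup>2"
    using H by (simp add: norms power2_eq_square)
  also have "\<dots> \<le> 2 * r * (norm (a' - b') + norm (b' - c') + norm (c' - a'))"
    using chord[OF norms(1,2)] chord[OF norms(2,3)] chord[OF norms(3,1)]
    by (simp add: distrib_left)
  finally have "4 * r \<le> norm (a' - b') + norm (b' - c') + norm (c' - a')"
    using True by simp
  then show ?thesis by (simp add: defs dist_norm)
next
  case False
  then show ?thesis
    using zero_le_dist[of a b] zero_le_dist[of b c] zero_le_dist[of c a] by linarith
qed

section \<open>The best constant\<close>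

text \<open>
  The function \<open>pos\<close> selects for each support point one position where it occurs. Replacing the
  entry at any other position keeps the support, hence gives at least the radius of \<open>xs\<close>; the
  selected positions have to contribute \<open>card S - 1\<close> times that radius.
\<close>
lemma d_r_simplex_inequality:
  assumes "xs \<noteq> []"
  shows "(real (length xs) - 1) * d_r xs \<le> (\<Sum>i<length xs. d_r (xs[i := z]))"
proof -
  let ?f = "\<lambda>i. d_r (xs[i := z])"
  obtain c S where S: "set xs \<subseteq> cball c (d_r xs)" "S \<subseteq> set xs" "S \<subseteq> sphere c (d_r xs)"
    "c \<in> convex hull S" "card S \<le> 3"
    by (rule d_r_support[OF assms])
  have fin: "finite S" using S(2) finite_subset by blast
  have "S \<noteq> {}" using S(4) by auto
  have nn: "0 \<le> ?f i" for i using assms by (intro d_r_nonneg) simp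
  have "\<forall>s\<in>S. \<exists>i<length xs. xs ! i = s" using S(2) by (auto simp: in_set_conv_nth)
  then obtain pos where pos: "\<And>s. s \<in> S \<Longrightarrow> pos s < length xs \<and> xs ! pos s = s" by metis
  then have inj: "inj_on pos S" by (metis inj_onI)
  have keep: "s \<in> set (xs[i := z])" if "s \<in> S" "i \<noteq> pos s" for s i
    using pos[OF that(1)] that(2) by (metis length_list_update nth_list_update_neq nth_mem)
  have new: "z \<in> set (xs[pos s := z])" if "s \<in> S" for s
    using pos[OF that] by (simp add: set_update_memI)
  have bound: "dist a b / 2 \<le> ?f (pos s)"
    if "s \<in> S" "a \<in> insert z (S - {s})" "b \<in> insert z (S - {s})" for s a b
    using that keep new inj by (intro half_dist_le_d_r) (auto dest: inj_onD)
  have off: "d_r xs \<le> ?f i" if "i \<notin> pos ` S" for i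
  proof -
    have "S \<subseteq> set (xs[i := z])" using keep that by blast
    moreover obtain c' where "set (xs[i := z]) \<subseteq> cball c' (?f i)"
      using ex_cball_d_r[of "xs[i := z]"] assms by auto
    ultimately show ?thesis
      using radius_le_if_centre_in_convex_hull[OF S(3,4)] by blast
  qed
  have on: "(real (card S) - 1) * d_r xs \<le> (\<Sum>s\<in>S. ?f (pos s))"
  proof -
    have "card S \<noteq> 0" using fin \<open>S \<noteq> {}\<close> by simp
    with S(5) consider "card S = 1" | "card S = 2" | "card S = 3" by linarith
    then show ?thesis
    proof cases
      case 1
      then show ?thesis using nn by (simp add: sum_nonneg)
    next
      case 2
      then obtain a b where ab: "S = {a, b}" "a \<noteq> b" by (auto simp: card_2_iff)
      \<comment> \<open>A support of two points is a degenerate triangle.\<close>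
      have "4 * d_r xs \<le> dist a b + dist b b + dist b a"
        using S(3,4) ab(1) by (intro perimeter_ge[of a b b c]) auto
      moreover have "dist b z / 2 \<le> ?f (pos a)" "dist a z / 2 \<le> ?f (pos b)"
        using ab by (intro bound; auto)+
      ultimately show ?thesis
        using ab dist_triangle2[of a b z] dist_commute[of a b] by simp
    next
      case 3
      then obtain u v w where uvw: "S = {u, v, w}" "u \<noteq> v" "v \<noteq> w" "w \<noteq> u"
        by (auto simp: card_3_iff)
      have "4 * d_r xs \<le> dist u v + dist v w + dist w u"
        using S(3,4) uvw(1) by (intro perimeter_ge[of u v w c]) auto
      moreover have "dist v w / 2 \<le> ?f (pos u)" "dist w u / 2 \<le> ?f (pos v)"
        "dist u v / 2 \<le> ?f (pos w)"
        using uvw by (intro bound; auto)+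
      ultimately show ?thesis using uvw by simp
    qed
  qed
  have sub: "pos ` S \<subseteq> {..<length xs}" using pos by auto
  have card: "real (card ({..<length xs} - pos ` S)) = real (length xs) - real (card S)"
    using sub card_mono[OF _ sub] by (simp add: card_Diff_subset fin card_image inj of_nat_diff)
  have "(real (length xs) - 1) * d_r xs
      = (real (length xs) - real (card S)) * d_r xs + (real (card S) - 1) * d_r xs"
    by (simp add: algebra_simps)
  also have "\<dots> \<le> (\<Sum>i\<in>{..<length xs} - pos ` S. ?f i) + (\<Sum>s\<in>S. ?f (pos s))"
    using sum_bounded_below[of "{..<length xs} - pos ` S" "d_r xs" ?f] off on card
    by (intro add_mono) auto
  also have "(\<Sum>s\<in>S. ?f (pos s)) = (\<Sum>i\<in>pos ` S. ?f i)"
    by (simp add: sum.reindex inj)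
  also have "(\<Sum>i\<in>{..<length xs} - pos ` S. ?f i) + \<dots> = (\<Sum>i<length xs. ?f i)"
    by (rule sum.subset_diff[OF sub, symmetric]) simp
  finally show ?thesis .
qed

lemma n_distance_d_r:
  assumes "n \<ge> 2"
  shows "n_distance n UNIV d_r"
  unfolding n_distance_def
proof (intro conjI ballI allI impI)
  fix xs :: "(real^2) list" assume "xs \<in> tuples n UNIV"
  then have len: "length xs = n" and ne: "xs \<noteq> []" using assms by (auto simp: tuples_def)
  show nn: "0 \<le> d_r xs" using d_r_nonneg[OF ne] .
  show "d_r xs \<le> (\<Sum>i<n. d_r (xs[i := z]))" for z
  proof -
    have "1 * d_r xs \<le> (real n - 1) * d_r xs" using assms nn by (intro mult_right_mono) auto
    then show ?thesis using d_r_simplex_inequality[OF ne, of z] len by simp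
  qed
  show "d_r (permute_list \<sigma> xs) = d_r xs" if "\<sigma> permutes {..<n}" for \<sigma>
  proof -
    have "set (permute_list \<sigma> xs) = set xs" using that len by simp
    moreover have "permute_list \<sigma> xs \<noteq> []" using ne len by (metis length_0_conv length_permute_list)
    ultimately show ?thesis using ne by (intro antisym d_r_mono) auto
  qed
  show "d_r xs = 0 \<longleftrightarrow> (\<forall>i<n. \<forall>j<n. xs ! i = xs ! j)"
    unfolding d_r_eq_0_iff[OF ne] using len by (auto simp: all_set_conv_all_nth)
qed simp

lemma best_constant_d_r:
  assumes "n \<ge> 2"
  shows "best_constant n (UNIV :: (real^2) set) d_r = 1 / (real n - 1)"
  unfolding best_constant_def
proof (rule cInf_eq_minimum)
  have n1: "real n - 1 \<ge> 1" using assms by simp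
  have "d_r xs \<le> 1 / (real n - 1) * (\<Sum>i<n. d_r (xs[i := z]))"
    if "xs \<in> tuples n UNIV" for xs z
  proof -
    have "xs \<noteq> []" "length xs = n" using that assms by (auto simp: tuples_def)
    then have "(real n - 1) * d_r xs \<le> (\<Sum>i<n. d_r (xs[i := z]))"
      using d_r_simplex_inequality by blast
    then show ?thesis using n1 by (simp add: field_simps)
  qed
  with n1 show "1 / (real n - 1) \<in> {K. 0 < K \<and> K \<le> 1 \<and>
      (\<forall>xs\<in>tuples n UNIV. \<forall>z\<in>UNIV. d_r xs \<le> K * (\<Sum>i<n. d_r (xs[i := z])))}"
    by (auto simp: divide_simps)
next
  fix K assume K: "K \<in> {K. 0 < K \<and> K \<le> 1 \<and>
      (\<forall>xs\<in>tuples n UNIV. \<forall>z\<in>UNIV. d_r xs \<le> K * (\<Sum>i<n. d_r (xs[i := z])))}"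
  obtain m where n: "n = Suc m" and "m \<ge> 1" using assms by (cases n) auto
  define a b :: "real^2" where "a = 0" and "b = 1"
  have "a \<noteq> b" by (simp add: a_def b_def)
  define xs where "xs = a # replicate m b"
  have len: "length xs = n" by (simp add: xs_def n)
  have ne: "xs \<noteq> []" by (simp add: xs_def)
  have "d_r xs \<noteq> 0"
    using \<open>a \<noteq> b\<close> \<open>m \<ge> 1\<close> by (subst d_r_eq_0_iff[OF ne]) (auto simp: xs_def)
  then have pos: "0 < d_r xs" using d_r_nonneg[OF ne] by simp
  \<comment> \<open>Only the replacement of \<open>a\<close> changes the tuple, and it makes all entries equal.\<close>
  have tail: "xs[Suc i := b] = xs" if "i < m" for i
    using that list_update_id[of "replicate m b" i] by (simp add: xs_def)
  have head: "d_r (xs[0 := b]) = 0"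
    by (subst d_r_eq_0_iff) (auto simp: xs_def)
  have "(\<Sum>i<n. d_r (xs[i := b])) = d_r (xs[0 := b]) + (\<Sum>i<m. d_r (xs[Suc i := b]))"
    unfolding n by (rule sum.lessThan_Suc_shift)
  also have "\<dots> = real m * d_r xs" using head tail by simp
  finally have sum: "(\<Sum>i<n. d_r (xs[i := b])) = real m * d_r xs" .
  have "xs \<in> tuples n UNIV" using len by (simp add: tuples_def)
  with K have "d_r xs \<le> K * (\<Sum>i<n. d_r (xs[i := b]))" by blast
  then have "d_r xs \<le> K * (real m * d_r xs)" by (simp only: sum)
  then have "1 * d_r xs \<le> (K * real m) * d_r xs" by simp
  then have "1 \<le> K * real m" using pos by (simp only: mult_le_cancel_right_pos)
  then show "1 / (real n - 1) \<le> K" using n \<open>m \<ge> 1\<close> by (simp add: field_simps)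
qed

theorem proposition4p3:
  fixes n :: nat
  assumes "n \<ge> 2"
  shows "n_distance n (UNIV :: (real^2) set) d_r \<and>
         best_constant n (UNIV :: (real^2) set) d_r = 1 / (real n - 1)"
  using n_distance_d_r[OF assms] best_constant_d_r[OF assms] by blast

end
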